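(* For any $x,y\in S$, we have $$\frac{\varphi(x)}{\varphi(y)}=\mathbb{E}\big[\exp(\lambda_0\tau^x_y)\,\mathbf{1}_{\{\tau^x_y<\tau^x_\infty\}}\big].$$ In particular, with $O:=\{x\in S : \bar L(x,\infty)>0\}$, we have $$a_\varphi=\max_{x\in S,\ y\in O}\mathbb{E}\big[\exp(\lambda_0\tau^x_y)\,\mathbf{1}_{\{\tau^x_y<\tau^x_\infty\}}\big].$$
   Context: Setting: $S$ is a finite nonempty set, $\bar S:=S\sqcup\{\infty\}$, and $\bar L=(\bar L(x,y))_{x,y\in\bar S}$ is a Markov generator matrix (off-diagonal entries non-negative, each row sums to $0$). Its restriction $K$ to $S\times S$ is irreducible (any point of $S$ can be joined to any other by a path in $S$ along entries $\bar L(\cdot,\cdot)>0$), $\bar L(\infty,x)=0$ for all $x\in\bar S$ (so $\infty$ is absorbing), and there exists $x\in S$ with $\bar L(x,\infty)>0$. By Perron-Frobenius, $-K$ has a unique eigenvalue $\lambda_0$ admitting a positive eigenvector; it is simple (and $\lambda_0>0$). Let $\varphi:S\to(0,\infty)$ be such an eigenvector: $K\varphi=-\lambda_0\varphi$. Its amplitude is $a_\varphi:=\max_{x\in S}\varphi(x)/\min_{x\in S}\varphi(x)$. For $x\in S$, $X^x=(X^x_t)_{t\ge0}$ is a càdlàg Markov process on $\bar S$ generated by $\bar L$ and starting from $x$; for $y\in\bar S$, $\tau^x_y:=\inf\{t\ge0 : X^x_t=y\}$, with $\tau^x_y=+\infty$ if $X^x$ never reaches $y$. *)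

theory Defs
  imports "HOL-Probability.Probability"
begin

text \<open>
  The extended state space is \<^typ>\<open>'a option\<close>: \<open>Some x\<close> is the state \<open>x \<in> S\<close> (with \<open>S\<close> the
  whole finite type \<^typ>\<open>'a\<close>) and \<^term>\<open>None\<close> is the cemetery point \<open>\<infinity>\<close>.
\<close>

definition markov_generator :: "real^'s^'s::finite \<Rightarrow> bool" where
  "markov_generator L \<longleftrightarrow>
     (\<forall>x y. x \<noteq> y \<longrightarrow> 0 \<le> L $ x $ y) \<and> (\<forall>x. (\<Sum>y\<in>UNIV. L $ x $ y) = 0)"

definition restrict_S :: "real^('a option)^('a option) \<Rightarrow> real^'a^'a::finite" where
  "restrict_S L = (\<chi> x y. L $ Some x $ Some y)"

definition irreducible_matrix :: "real^'a^'a::finite \<Rightarrow> bool" where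
  "irreducible_matrix K \<longleftrightarrow> (\<forall>x y. (x, y) \<in> {(u, v). 0 < K $ u $ v}\<^sup>*)"

text \<open>
  The product \<open>*\<close> on \<^typ>\<open>real^'s^'s::finite\<close> is componentwise, so the powers of a matrix are taken
  with respect to \<open>**\<close> explicitly.
\<close>

definition matrix_exp :: "real^'s^'s::finite \<Rightarrow> real^'s^'s" where
  "matrix_exp A = (\<Sum>n. (1 / fact n) *\<^sub>R ((\<lambda>B. A ** B) ^^ n) (mat 1))"

text \<open>Limits of the paths are taken in the discrete topology of the state space.\<close>

definition cadlag_path :: "(real \<Rightarrow> 's) \<Rightarrow> bool" where
  "cadlag_path f \<longleftrightarrow>
     (\<forall>t\<ge>0. limitin (discrete_topology UNIV) f (f t) (at_right t)) \<and>
     (\<forall>t>0. \<exists>z. limitin (discrete_topology UNIV) f z (at_left t))"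

definition natural_filtration :: "'w measure \<Rightarrow> (real \<Rightarrow> 'w \<Rightarrow> 's) \<Rightarrow> real \<Rightarrow> 'w measure" where
  "natural_filtration M X s =
     sigma (space M) {X u -` B \<inter> space M | u B. 0 \<le> u \<and> u \<le> s}"

text \<open>
  The Markov property with respect to the natural filtration, with transition semigroup
  \<open>exp (t L)\<close>. Only the times \<open>t \<ge> 0\<close> of a process are relevant.
\<close>

definition cadlag_markov_process ::
    "real^'s^'s::finite \<Rightarrow> 'w measure \<Rightarrow> (real \<Rightarrow> 'w \<Rightarrow> 's) \<Rightarrow> bool" where
  "cadlag_markov_process L M X \<longleftrightarrow>
     prob_space M \<and>
     (\<forall>t\<ge>0. X t \<in> M \<rightarrow>\<^sub>M count_space UNIV) \<and>
     (\<forall>\<omega>\<in>space M. cadlag_path (\<lambda>t. X t \<omega>)) \<and>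
     (\<forall>s\<ge>0. \<forall>t\<ge>0. \<forall>z. AE \<omega> in M.
        real_cond_exp M (natural_filtration M X s) (indicator {\<omega>. X (s + t) \<omega> = z}) \<omega>
          = matrix_exp (t *\<^sub>R L) $ X s \<omega> $ z)"

definition starts_from :: "'w measure \<Rightarrow> (real \<Rightarrow> 'w \<Rightarrow> 's) \<Rightarrow> 's \<Rightarrow> bool" where
  "starts_from M X x \<longleftrightarrow> (AE \<omega> in M. X 0 \<omega> = x)"

text \<open>The infimum over the empty set is \<open>\<infinity>\<close> in \<^typ>\<open>ereal\<close>.\<close>

definition hitting_time :: "(real \<Rightarrow> 'w \<Rightarrow> 's) \<Rightarrow> 's \<Rightarrow> 'w \<Rightarrow> ereal" where
  "hitting_time X y \<omega> = (INF t\<in>{t. 0 \<le> t \<and> X t \<omega> = y}. ereal t)"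

text \<open>
  The random variable \<open>exp (c \<tau>\<^sub>y) 1{\<tau>\<^sub>y < \<tau>\<^sub>\<infinity>}\<close>. On the event in the indicator the hitting time is
  finite, so the junk value of \<^const>\<open>real_of_ereal\<close> at \<open>\<infinity>\<close> plays no role.
\<close>

definition exp_hit_before_killing ::
    "real \<Rightarrow> (real \<Rightarrow> 'w \<Rightarrow> 'a option) \<Rightarrow> 'a \<Rightarrow> 'w \<Rightarrow> real" where
  "exp_hit_before_killing c X y \<omega> =
     exp (c * real_of_ereal (hitting_time X (Some y) \<omega>)) *
     indicator {\<omega>. hitting_time X (Some y) \<omega> < hitting_time X None \<omega>} \<omega>"

definition amplitude :: "real^'a::finite \<Rightarrow> real" where
  "amplitude \<phi> = (MAX x. \<phi> $ x) / (MIN x. \<phi> $ x)"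

definition exit_states :: "real^('a option)^('a option) \<Rightarrow> 'a::finite set" where
  "exit_states L = {x. 0 < L $ Some x $ None}"

end

theory Submission
  imports Defs
begin

text \<open>
  Extend \<open>\<phi>\<close> by \<open>0\<close> at \<open>\<infinity>\<close> to a vector \<open>g\<close> with \<open>L g = - \<lambda>\<^sub>0 g\<close>. Then \<open>exp (t L) g = exp (- \<lambda>\<^sub>0 t) g\<close>, so
  \<open>exp (\<lambda>\<^sub>0 t) g(X\<^sub>t)\<close> is a martingale. Stopping it at \<open>\<tau>\<^sub>y \<and> N\<close> gives
  \<open>\<phi>(x) = \<phi>(y) E[exp (\<lambda>\<^sub>0 \<tau>\<^sub>y); \<tau>\<^sub>y \<le> N] + E[exp (\<lambda>\<^sub>0 N) g(X\<^sub>N); \<tau>\<^sub>y > N]\<close>, and the formula follows by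
  letting \<open>N\<close> tend to \<open>\<infinity>\<close>, once the last term is known to vanish and \<open>\<tau>\<^sub>y < \<tau>\<^sub>\<infinity>\<close> is known to mean
  \<open>\<tau>\<^sub>y < \<infinity>\<close> almost surely.

  Optional stopping is first carried out in discrete time. On the grid of the points \<open>j N / n\<close> the
  stopped martingale is a finite sum of martingale increments, each multiplied by the
  indicator of the past event that the chain has avoided \<open>y\<close> so far; hence its expectation is that of
  \<open>g(X\<^sub>0)\<close> (\<open>expectation_stopped\<close>). As \<open>n\<close> grows the first grid point at which the chain is in \<open>y\<close>
  tends to \<open>\<tau>\<^sub>y\<close> if \<open>\<tau>\<^sub>y \<le> N\<close>, because a right-continuous path stays in \<open>y\<close> for some time after \<open>\<tau>\<^sub>y\<close>
  (\<open>stopped_tendsto\<close>), and the stopped values are bounded, so dominated convergence applies.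

  For the remaining term, irreducibility gives a time \<open>H > 0\<close> such that every transition within \<open>S\<close> in
  time \<open>H\<close> has positive probability (\<open>common_time_positive_transitions\<close>). The martingale mass carried by
  the paths that avoid \<open>y\<close> at the times \<open>0, H, \<dots>, k H\<close> then loses at least a fixed proportion in every
  step, since that proportion sits in \<open>y\<close> at the next time (\<open>avoiding_mass_decay\<close>). The mass at time
  \<open>k H\<close> of the paths with \<open>\<tau>\<^sub>y > k H\<close> is at most that.

  Finally \<open>{\<tau>\<^sub>y < \<tau>\<^sub>\<infinity>}\<close> and \<open>{\<tau>\<^sub>y < \<infinity>}\<close> agree almost surely because the zero set of the nonnegative
  eigenvector \<open>g\<close>, which is \<open>{\<infinity>}\<close>, is absorbing: the martingale cannot leave \<open>0\<close>.

  The amplitude is the largest ratio \<open>\<phi>(x) / \<phi>(y)\<close> over all \<open>x, y \<in> S\<close>. The maximum principle at a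
  maximum point of \<open>\<phi>\<close> gives \<open>\<lambda>\<^sub>0 > 0\<close>, and at a minimum point it then shows that a minimizer must be able
  to exit to \<open>\<infinity>\<close>; so \<open>y\<close> may be restricted to the exit states.
\<close>

section \<open>The matrix exponential\<close>

definition matpow :: "real^'s^'s::finite \<Rightarrow> nat \<Rightarrow> real^'s^'s" where
  "matpow A n = ((\<lambda>B. A ** B) ^^ n) (mat 1)"

lemma matpow_0 [simp]: "matpow A 0 = mat 1"
  and matpow_Suc: "matpow A (Suc n) = A ** matpow A n"
  by (simp_all add: matpow_def)

lemma matpow_Suc_entry: "matpow A (Suc n) $ x $ z = (\<Sum>k\<in>UNIV. A $ x $ k * matpow A n $ k $ z)"
  by (simp add: matpow_Suc matrix_matrix_mult_def)

lemma matpow_scaleR_entry: "matpow (t *\<^sub>R A) n $ x $ z = t ^ n * matpow A n $ x $ z"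
  by (induction n arbitrary: x)
     (simp_all add: matpow_Suc_entry sum_distrib_left mult_ac)

text \<open>
  An entry of \<open>A\<^sup>n\<close> is a sum over paths of length \<open>n\<close>. The bound by the \<open>n\<close>-th power of the sum of all
  \<open>\<bar>A $ i $ j\<bar>\<close> is crude, but it makes every entry of the exponential series converge absolutely.
\<close>

lemma abs_matpow_entry_le: "\<bar>matpow A n $ x $ z\<bar> \<le> (\<Sum>i\<in>UNIV. \<Sum>j\<in>UNIV. \<bar>A $ i $ j\<bar>) ^ n"
proof (induction n arbitrary: x)
  case 0
  then show ?case by (simp add: mat_def)
next
  case (Suc n)
  let ?C = "\<Sum>i\<in>UNIV. \<Sum>j\<in>UNIV. \<bar>A $ i $ j\<bar>"
  have "\<bar>matpow A (Suc n) $ x $ z\<bar> \<le> (\<Sum>k\<in>UNIV. \<bar>A $ x $ k\<bar> * \<bar>matpow A n $ k $ z\<bar>)"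
    unfolding matpow_Suc_entry by (rule order_trans[OF sum_abs]) (simp add: abs_mult)
  also have "\<dots> \<le> (\<Sum>k\<in>UNIV. \<bar>A $ x $ k\<bar> * ?C ^ n)"
    by (intro sum_mono mult_left_mono Suc.IH) auto
  also have "\<dots> = (\<Sum>k\<in>UNIV. \<bar>A $ x $ k\<bar>) * ?C ^ n"
    by (simp add: sum_distrib_right)
  also have "\<dots> \<le> ?C * ?C ^ n"
    by (intro mult_right_mono member_le_sum[where f = "\<lambda>i. \<Sum>k\<in>UNIV. \<bar>A $ i $ k\<bar>"])
       (auto intro!: sum_nonneg zero_le_power)
  finally show ?case by simp
qed

lemma summable_exp_matpow_entry: "summable (\<lambda>n. matpow A n $ x $ z / fact n)"
proof (rule summable_comparison_test'[where N = 0])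
  let ?C = "\<Sum>i\<in>UNIV. \<Sum>j\<in>UNIV. \<bar>A $ i $ j\<bar>"
  show "summable (\<lambda>n. inverse (fact n) * ?C ^ n)" by (rule summable_exp)
  show "norm (matpow A n $ x $ z / fact n) \<le> inverse (fact n) * ?C ^ n" for n
    using abs_matpow_entry_le[of A n x z] by (simp add: field_simps)
qed

text \<open>
  The exponential of a matrix can be computed entry by entry, which reduces all that follows to real
  power series.
\<close>

lemma matrix_exp_entry_sums: "(\<lambda>n. matpow A n $ x $ z / fact n) sums (matrix_exp A $ x $ z)"
proof -
  let ?S = "\<chi> x z. \<Sum>n. matpow A n $ x $ z / fact n"
  have "(\<lambda>n. (1 / fact n) *\<^sub>R matpow A n) sums ?S"
    unfolding sums_def
  proof (intro vec_tendstoI)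
    fix x z
    show "(\<lambda>N. (\<Sum>n<N. (1 / fact n) *\<^sub>R matpow A n) $ x $ z) \<longlonglongrightarrow> ?S $ x $ z"
      using summable_LIMSEQ[OF summable_exp_matpow_entry[of A x z]] by simp
  qed
  then have "matrix_exp A = ?S"
    unfolding matrix_exp_def matpow_def by (rule sums_unique[symmetric])
  then show ?thesis
    using summable_exp_matpow_entry[of A x z] by (simp add: summable_sums)
qed

text \<open>
  A state with a zero row never moves: the row of \<open>A\<^sup>n\<close> vanishes for \<open>n \<ge> 1\<close>, leaving the identity.
\<close>

lemma matrix_exp_zero_row:
  assumes "\<And>k. A $ x $ k = 0"
  shows "matrix_exp A $ x $ z = mat 1 $ x $ z"
proof -
  have "matpow A n $ x $ z / fact n = (if n = 0 then mat 1 $ x $ z else 0)" for n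
    using assms by (cases n) (simp_all add: matpow_Suc_entry)
  then show ?thesis
    using matrix_exp_entry_sums[of A x z] sums_single[of 0 "\<lambda>_. mat 1 $ x $ z"]
    by (auto dest: sums_unique2)
qed

lemma matrix_exp_zero: "matrix_exp 0 = mat 1"
  by (simp add: vec_eq_iff matrix_exp_zero_row)

lemma matrix_exp_eigenvector:
  assumes "A *v g = \<mu> *\<^sub>R g"
  shows "matrix_exp A *v g = exp \<mu> *\<^sub>R g"
proof -
  have A: "(\<Sum>k\<in>UNIV. A $ x $ k * g $ k) = \<mu> * g $ x" for x
    using arg_cong[OF assms, of "\<lambda>v. v $ x"] by (simp add: matrix_vector_mult_def)
  have pow: "matpow A n *v g = \<mu> ^ n *\<^sub>R g" for n
    by (induction n)
       (simp_all add: matpow_Suc matrix_vector_mul_assoc[symmetric] assms matrix_vector_mult_scaleR)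
  have "(matrix_exp A *v g) $ x = exp \<mu> * g $ x" for x
  proof (rule sums_unique2)
    have "(\<lambda>n. \<Sum>z\<in>UNIV. matpow A n $ x $ z / fact n * g $ z) sums
            (\<Sum>z\<in>UNIV. matrix_exp A $ x $ z * g $ z)"
      by (intro sums_sum sums_mult2 matrix_exp_entry_sums)
    also have "(\<lambda>n. \<Sum>z\<in>UNIV. matpow A n $ x $ z / fact n * g $ z)
        = (\<lambda>n. (matpow A n *v g) $ x / fact n)"
      by (simp add: matrix_vector_mult_def sum_divide_distrib)
    also have "\<dots> = (\<lambda>n. \<mu> ^ n /\<^sub>R fact n * g $ x)"
      by (simp add: pow field_simps)
    finally show "(\<lambda>n. \<mu> ^ n /\<^sub>R fact n * g $ x) sums ((matrix_exp A *v g) $ x)"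
      by (simp add: matrix_vector_mult_def)
    show "(\<lambda>n. \<mu> ^ n /\<^sub>R fact n * g $ x) sums (exp \<mu> * g $ x)"
      by (intro sums_mult2 exp_converges)
  qed
  then show ?thesis by (simp add: vec_eq_iff)
qed

text \<open>
  The entry is a power series in \<open>t\<close> whose linear coefficient is \<open>A $ x $ z\<close>.
\<close>

lemma has_derivative_matrix_exp_entry_0:
  "((\<lambda>t. matrix_exp (t *\<^sub>R A) $ x $ z) has_real_derivative A $ x $ z) (at 0)"
proof -
  define c where "c n = matpow A n $ x $ z / fact n" for n
  have eq: "(\<lambda>n. c n * t ^ n) sums (matrix_exp (t *\<^sub>R A) $ x $ z)" for t
    using matrix_exp_entry_sums[of "t *\<^sub>R A" x z]
    by (simp add: matpow_scaleR_entry c_def mult.commute)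
  have "((\<lambda>t. \<Sum>n. c n * t ^ n) has_real_derivative (\<Sum>n. diffs c n * 0 ^ n)) (at 0)"
    using eq by (intro termdiffs_strong_converges_everywhere) (rule sums_summable)
  also have "(\<lambda>t. \<Sum>n. c n * t ^ n) = (\<lambda>t. matrix_exp (t *\<^sub>R A) $ x $ z)"
    using eq by (intro ext sums_unique[symmetric])
  also have "(\<Sum>n. diffs c n * 0 ^ n) = A $ x $ z"
    unfolding powser_zero by (simp add: diffs_def c_def matpow_Suc)
  finally show ?thesis .
qed

text \<open>
  On the diagonal the entry starts at \<open>1\<close> and is continuous; off the diagonal it starts at \<open>0\<close> with
  derivative \<open>A $ x $ z > 0\<close>.
\<close>

lemma matrix_exp_entry_pos_near_0:
  assumes "x = z \<or> 0 < A $ x $ z"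
  shows "eventually (\<lambda>t. 0 < matrix_exp (t *\<^sub>R A) $ x $ z) (at_right 0)"
proof (cases "x = z")
  case True
  have "isCont (\<lambda>t. matrix_exp (t *\<^sub>R A) $ x $ z) 0"
    by (rule DERIV_isCont[OF has_derivative_matrix_exp_entry_0])
  then have "((\<lambda>t. matrix_exp (t *\<^sub>R A) $ x $ z) \<longlongrightarrow> 1) (at 0)"
    using True by (simp add: isCont_def matrix_exp_zero mat_def)
  then show ?thesis
    by (intro order_tendstoD(1)[where y = 1]) (auto simp: filterlim_at_split)
next
  case False
  with assms obtain d where "d > 0" and
      "\<And>h. 0 < h \<Longrightarrow> h < d \<Longrightarrow> matrix_exp (0 *\<^sub>R A) $ x $ z < matrix_exp ((0 + h) *\<^sub>R A) $ x $ z"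
    using has_real_derivative_pos_inc_right[OF has_derivative_matrix_exp_entry_0[of A x z]] by auto
  with False show ?thesis
    by (auto simp: eventually_at_right_field matrix_exp_zero mat_def intro!: exI[of _ d])
qed

section \<open>Hitting times of right-continuous paths\<close>

lemma cadlag_path_right:
  assumes "cadlag_path f" "0 \<le> t"
  obtains d where "d > 0" "\<And>u. t \<le> u \<Longrightarrow> u < t + d \<Longrightarrow> f u = f t"
proof -
  have "limitin (discrete_topology UNIV) f (f t) (at_right t)"
    using assms by (simp add: cadlag_path_def)
  then have "eventually (\<lambda>u. f u \<in> {f t}) (at_right t)"
    unfolding limitin_def openin_discrete_topology by blast
  then obtain b where "b > t" "\<And>u. t < u \<Longrightarrow> u < b \<Longrightarrow> f u = f t"
    by (auto simp: eventually_at_right_field)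
  then show ?thesis
    by (intro that[of "b - t"]) (auto simp: le_less)
qed

text \<open>
  Rational times see every value of a right-continuous path; this turns almost sure statements about
  countably many times into statements about all times.
\<close>

lemma cadlag_path_rational_right:
  assumes "cadlag_path f" "0 \<le> t" "t < b"
  obtains q where "q \<in> \<rat>" "t < q" "q < b" "f q = f t"
proof -
  obtain d where d: "d > 0" "\<And>u. t \<le> u \<Longrightarrow> u < t + d \<Longrightarrow> f u = f t"
    using cadlag_path_right[OF assms(1,2)] by blast
  obtain q where "q \<in> \<rat>" "t < q" "q < min b (t + d)"
    using Rats_dense_in_real[of t "min b (t + d)"] assms(3) d(1) by auto
  then show ?thesis using that[of q] d(2)[of q] by auto
qed

lemma hitting_time_le:
  assumes "0 \<le> t" "X t \<omega> = y"
  shows "hitting_time X y \<omega> \<le> ereal t"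
  unfolding hitting_time_def using assms by (intro INF_lower) auto

text \<open>
  The infimum is a minimum: the path is constant on an interval to the right of the infimum, and that
  interval contains a time at which the path is in \<open>y\<close>.
\<close>

lemma hitting_time_attained:
  assumes cad: "cadlag_path (\<lambda>t. X t \<omega>)" and fin: "hitting_time X y \<omega> < \<infinity>"
  obtains t where "0 \<le> t" "hitting_time X y \<omega> = ereal t" "X t \<omega> = y"
    "\<And>u. 0 \<le> u \<Longrightarrow> u < t \<Longrightarrow> X u \<omega> \<noteq> y"
proof -
  let ?T = "{t. 0 \<le> t \<and> X t \<omega> = y}"
  have ne: "?T \<noteq> {}" 
    using fin unfolding hitting_time_def by (metis INF_empty less_irrefl top_ereal_def)
  have bdd: "bdd_below ?T" by (auto intro: bdd_belowI[of _ 0])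
  define t where "t = Inf ?T"
  have t0: "0 \<le> t" unfolding t_def using ne by (intro cInf_greatest) auto
  have least: "t \<le> u" if "0 \<le> u" "X u \<omega> = y" for u
    unfolding t_def using that bdd by (intro cInf_lower) auto
  obtain d where d: "d > 0" "\<And>u. t \<le> u \<Longrightarrow> u < t + d \<Longrightarrow> X u \<omega> = X t \<omega>"
    using cadlag_path_right[OF cad t0] by blast
  have "Inf ?T < t + d" using d(1) by (simp add: t_def)
  then obtain u where "0 \<le> u" "X u \<omega> = y" "u < t + d"
    using cInf_less_iff[OF ne bdd] by blast
  with d(2)[of u] least[of u] have hit: "X t \<omega> = y" by auto
  have "hitting_time X y \<omega> = ereal t"
    unfolding hitting_time_def using least hit t0 by (intro INF_eqI) auto
  then show ?thesis
    using that[of t] t0 hit least not_le by blast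
qed

text \<open>
  This exhibits \<open>{\<tau>\<^sub>y < a}\<close> as a countable union, which makes \<open>\<tau>\<^sub>y\<close> measurable.
\<close>

lemma hitting_time_less_iff_rational:
  assumes cad: "cadlag_path (\<lambda>t. X t \<omega>)"
  shows "hitting_time X y \<omega> < a \<longleftrightarrow> (\<exists>q\<in>{q\<in>\<rat>. 0 \<le> q \<and> ereal q < a}. X q \<omega> = y)"
proof
  assume lt: "hitting_time X y \<omega> < a"
  then have fin: "hitting_time X y \<omega> < \<infinity>" by (rule less_le_trans) simp
  obtain t where t: "0 \<le> t" "hitting_time X y \<omega> = ereal t" "X t \<omega> = y"
    by (rule hitting_time_attained[of X \<omega> y, OF cad fin])
  obtain b where "ereal t < ereal b" "ereal b \<le> a"
    using lt t(2) ereal_dense2[of "ereal t" a] by auto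
  then obtain q where "q \<in> \<rat>" "t < q" "q < b" "X q \<omega> = X t \<omega>"
    using cadlag_path_rational_right[OF cad t(1), of b] by auto
  with t \<open>ereal b \<le> a\<close> show "\<exists>q\<in>{q\<in>\<rat>. 0 \<le> q \<and> ereal q < a}. X q \<omega> = y"
    using less_le_trans[of "ereal q" "ereal b" a] by (intro bexI[of _ q]) simp_all
next
  assume "\<exists>q\<in>{q\<in>\<rat>. 0 \<le> q \<and> ereal q < a}. X q \<omega> = y"
  then obtain q where "0 \<le> q" "ereal q < a" "X q \<omega> = y" by blast
  then show "hitting_time X y \<omega> < a"
    using hitting_time_le[of q X \<omega> y] by simp
qed

section \<open>Finite-dimensional laws\<close>

locale cadlag_markov =
  fixes L :: "real^'s^'s::finite" and M :: "'w measure" and X :: "real \<Rightarrow> 'w \<Rightarrow> 's"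
  assumes process: "cadlag_markov_process L M X"
begin

sublocale prob_space M
  using process by (simp add: cadlag_markov_process_def)

lemma X_measurable [measurable]: "0 \<le> t \<Longrightarrow> X t \<in> M \<rightarrow>\<^sub>M count_space UNIV"
  using process by (simp add: cadlag_markov_process_def)

lemma X_cadlag: "\<omega> \<in> space M \<Longrightarrow> cadlag_path (\<lambda>t. X t \<omega>)"
  using process by (simp add: cadlag_markov_process_def)

lemma space_natural_filtration [simp]: "space (natural_filtration M X s) = space M"
  by (simp add: natural_filtration_def space_measure_of_conv)

lemma sets_natural_filtration:
  "sets (natural_filtration M X s)
     = sigma_sets (space M) {X u -` B \<inter> space M | u B. 0 \<le> u \<and> u \<le> s}"
  unfolding natural_filtration_def by (intro sets_measure_of) auto

lemma subalgebra_natural_filtration: "subalgebra M (natural_filtration M X s)"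
proof -
  have "X u -` B \<inter> space M \<in> sets M" if "0 \<le> u" for u B
    using measurable_sets[OF X_measurable[OF that], of B] by simp
  then show ?thesis
    unfolding subalgebra_def sets_natural_filtration
    by (auto intro!: sets.sigma_sets_subset )
qed

lemma X_measurable_natural_filtration:
  "0 \<le> u \<Longrightarrow> u \<le> s \<Longrightarrow> X u \<in> natural_filtration M X s \<rightarrow>\<^sub>M count_space UNIV"
  by (intro measurableI) (auto simp: sets_natural_filtration intro!: sigma_sets.Basic)

lemma natural_filtration_sets_M: "A \<in> sets (natural_filtration M X s) \<Longrightarrow> A \<in> sets M"
  using subalgebra_natural_filtration[of s] by (auto simp: subalgebra_def)

lemma borel_measurable_state [measurable]:
  "0 \<le> t \<Longrightarrow> (\<lambda>\<omega>. f (X t \<omega>)) \<in> borel_measurable M"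
  by (rule measurable_compose[OF X_measurable]) simp_all

lemma integrable_indicator_state:
  fixes f :: "'s \<Rightarrow> real"
  assumes "0 \<le> t" and [measurable]: "A \<in> sets M"
  shows "integrable M (\<lambda>\<omega>. indicator A \<omega> * f (X t \<omega>))"
proof (rule integrable_const_bound)
  have "\<bar>f z\<bar> \<le> (\<Sum>z\<in>UNIV. \<bar>f z\<bar>)" for z
    by (rule member_le_sum[where f = "\<lambda>z. \<bar>f z\<bar>"]) auto
  moreover have "0 \<le> (\<Sum>z\<in>UNIV. \<bar>f z\<bar>)" by (rule sum_nonneg) simp
  ultimately show "AE \<omega> in M. norm (indicator A \<omega> * f (X t \<omega>)) \<le> (\<Sum>z\<in>UNIV. \<bar>f z\<bar>)"
    by (auto simp: indicator_def)
qed (use assms in measurable)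

text \<open>
  The Markov property is used in integrated form, against the indicator of an event of the past; this
  is the defining property of the conditional expectation.
\<close>

lemma markov_property_state:
  assumes st: "0 \<le> s" "0 \<le> t" and A: "A \<in> sets (natural_filtration M X s)"
  shows "(\<integral>\<omega>. indicator A \<omega> * indicator {z} (X (s + t) \<omega>) \<partial>M)
       = (\<integral>\<omega>. indicator A \<omega> * matrix_exp (t *\<^sub>R L) $ X s \<omega> $ z \<partial>M)"
proof -
  let ?F = "natural_filtration M X s"
  interpret F: finite_measure_subalgebra M ?F
    by unfold_locales (rule subalgebra_natural_filtration)
  let ?I = "indicator {\<omega>. X (s + t) \<omega> = z} :: _ \<Rightarrow> real"
  have I: "?I = (\<lambda>\<omega>. indicator {z} (X (s + t) \<omega>))"
    by (auto simp: indicator_def fun_eq_iff)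
  have int: "integrable M ?I"
    unfolding I using borel_measurable_state[of "s + t" "indicator {z}"] st
    by (intro integrable_const_bound[of _ 1]) auto
  have ae: "AE \<omega> in M. real_cond_exp M ?F ?I \<omega> = matrix_exp (t *\<^sub>R L) $ X s \<omega> $ z"
    using process st by (simp add: cadlag_markov_process_def)
  have [measurable]: "A \<in> sets M" using A by (rule natural_filtration_sets_M)
  have [measurable]: "(\<lambda>\<omega>. matrix_exp (t *\<^sub>R L) $ X s \<omega> $ z) \<in> borel_measurable M"
    using borel_measurable_state[OF st(1), of "\<lambda>w. matrix_exp (t *\<^sub>R L) $ w $ z"] .
  have "(\<integral>\<omega>. indicator A \<omega> * ?I \<omega> \<partial>M) = (\<integral>\<omega>. indicator A \<omega> * real_cond_exp M ?F ?I \<omega> \<partial>M)"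
    using F.real_cond_exp_intA[OF int A] by (simp add: set_lebesgue_integral_def)
  also have "\<dots> = (\<integral>\<omega>. indicator A \<omega> * matrix_exp (t *\<^sub>R L) $ X s \<omega> $ z \<partial>M)"
    by (rule integral_cong_AE) (use ae in auto)
  finally show ?thesis by (simp add: I)
qed

lemma markov_property:
  assumes st: "0 \<le> s" "0 \<le> t" and A: "A \<in> sets (natural_filtration M X s)"
  shows "(\<integral>\<omega>. indicator A \<omega> * g $ X (s + t) \<omega> \<partial>M)
       = (\<integral>\<omega>. indicator A \<omega> * (matrix_exp (t *\<^sub>R L) *v g) $ X s \<omega> \<partial>M)"
proof -
  have AM: "A \<in> sets M" using A by (rule natural_filtration_sets_M)
  have "(\<integral>\<omega>. indicator A \<omega> * g $ X (s + t) \<omega> \<partial>M)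
      = (\<integral>\<omega>. (\<Sum>z\<in>UNIV. (indicator A \<omega> * indicator {z} (X (s + t) \<omega>)) * g $ z) \<partial>M)"
    by (intro Bochner_Integration.integral_cong refl)
       (simp add: indicator_def sum.delta' if_distrib cong: if_cong)
  also have "\<dots> = (\<Sum>z\<in>UNIV. (\<integral>\<omega>. indicator A \<omega> * indicator {z} (X (s + t) \<omega>) \<partial>M) * g $ z)"
    using st AM by (subst Bochner_Integration.integral_sum)
      (auto intro!: integrable_mult_left integrable_indicator_state)
  also have "\<dots> = (\<Sum>z\<in>UNIV. (\<integral>\<omega>. indicator A \<omega> * matrix_exp (t *\<^sub>R L) $ X s \<omega> $ z \<partial>M) * g $ z)"
    using markov_property_state[OF st A] by simp
  also have "\<dots> = (\<integral>\<omega>. (\<Sum>z\<in>UNIV. (indicator A \<omega> * matrix_exp (t *\<^sub>R L) $ X s \<omega> $ z) * g $ z) \<partial>M)"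
    using st AM by (subst Bochner_Integration.integral_sum)
      (auto intro!: integrable_mult_left integrable_indicator_state[where f = "\<lambda>w. matrix_exp (t *\<^sub>R L) $ w $ _"])
  also have "\<dots> = (\<integral>\<omega>. indicator A \<omega> * (matrix_exp (t *\<^sub>R L) *v g) $ X s \<omega> \<partial>M)"
    by (intro Bochner_Integration.integral_cong refl)
       (simp add: matrix_vector_mult_def sum_distrib_left mult_ac)
  finally show ?thesis .
qed

lemma hitting_time_measurable [measurable]: "hitting_time X y \<in> borel_measurable M"
proof (rule borel_measurableI_less)
  fix a :: ereal
  let ?Q = "{q\<in>\<rat>. 0 \<le> q \<and> ereal q < a}"
  have "{\<omega> \<in> space M. hitting_time X y \<omega> < a} = (\<Union>q\<in>?Q. {\<omega> \<in> space M. X q \<omega> = y})"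
    using hitting_time_less_iff_rational[of X _ y a, OF X_cadlag] by auto
  also have "\<dots> \<in> sets M"
  proof (rule sets.countable_UN'')
    show "countable ?Q" by (rule countable_subset[OF _ countable_rat]) auto
    show "{\<omega> \<in> space M. X q \<omega> = y} \<in> sets M" if "q \<in> ?Q" for q
    proof -
      have [measurable]: "X q \<in> M \<rightarrow>\<^sub>M count_space UNIV" using that by simp
      show ?thesis by measurable
    qed
  qed
  finally show "{\<omega> \<in> space M. hitting_time X y \<omega> < a} \<in> sets M" .
qed

lemma prob_state_conditioned:
  assumes "0 \<le> s" "0 \<le> t"
  shows "prob {\<omega> \<in> space M. X s \<omega> = w \<and> X (s + t) \<omega> = z}
       = prob {\<omega> \<in> space M. X s \<omega> = w} * matrix_exp (t *\<^sub>R L) $ w $ z"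
proof -
  let ?A = "{\<omega> \<in> space M. X s \<omega> = w}"
  have "X s -` {w} \<inter> space M \<in> sets (natural_filtration M X s)"
    using measurable_sets[OF X_measurable_natural_filtration[OF assms(1) order_refl], of "{w}"] by simp
  also have "X s -` {w} \<inter> space M = ?A" by auto
  finally have A: "?A \<in> sets (natural_filtration M X s)" .
  have "prob {\<omega> \<in> space M. X s \<omega> = w \<and> X (s + t) \<omega> = z}
      = (\<integral>\<omega>. indicator {\<omega> \<in> space M. X s \<omega> = w \<and> X (s + t) \<omega> = z} \<omega> \<partial>M)"
    by simp (rule arg_cong[where f = prob], auto)
  also have "\<dots> = (\<integral>\<omega>. indicator ?A \<omega> * indicator {z} (X (s + t) \<omega>) \<partial>M)"
    by (intro Bochner_Integration.integral_cong refl) (auto simp: indicator_def)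
  also have "\<dots> = (\<integral>\<omega>. indicator ?A \<omega> * matrix_exp (t *\<^sub>R L) $ X s \<omega> $ z \<partial>M)"
    by (rule markov_property_state[OF assms A])
  also have "\<dots> = (\<integral>\<omega>. indicator ?A \<omega> * matrix_exp (t *\<^sub>R L) $ w $ z \<partial>M)"
    by (intro Bochner_Integration.integral_cong refl) (auto simp: indicator_def)
  also have "\<dots> = prob ?A * matrix_exp (t *\<^sub>R L) $ w $ z"
    by (simp add: Collect_conj_eq Int_commute)
  finally show ?thesis .
qed

lemma prob_state:
  assumes "starts_from M X x" "0 \<le> t"
  shows "prob {\<omega> \<in> space M. X t \<omega> = z} = matrix_exp (t *\<^sub>R L) $ x $ z"
proof -
  have ae: "AE \<omega> in M. X 0 \<omega> = x" using assms(1) by (simp add: starts_from_def)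
  have [measurable]: "X t \<in> M \<rightarrow>\<^sub>M count_space UNIV" "X 0 \<in> M \<rightarrow>\<^sub>M count_space UNIV"
    using assms(2) by simp_all
  have "prob {\<omega> \<in> space M. X t \<omega> = z} = prob {\<omega> \<in> space M. X 0 \<omega> = x \<and> X (0 + t) \<omega> = z}"
    by (rule finite_measure_eq_AE) (use ae in auto)
  also have "\<dots> = matrix_exp (t *\<^sub>R L) $ x $ z"
    using prob_state_conditioned[of 0 t x z] assms(2) ae
    by (simp add: prob_eq_1)
  finally show ?thesis .
qed

text \<open>
  One half of the Chapman-Kolmogorov identity: passing through \<open>w\<close> at time \<open>s\<close> is only one way to reach
  \<open>z\<close> at time \<open>s + t\<close>. It is what propagates positivity of transition probabilities along paths.
\<close>

lemma transition_product_le: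
  assumes x: "starts_from M X x" and st: "0 \<le> s" "0 \<le> t"
  shows "matrix_exp (s *\<^sub>R L) $ x $ w * matrix_exp (t *\<^sub>R L) $ w $ z
       \<le> matrix_exp ((s + t) *\<^sub>R L) $ x $ z"
proof -
  have "matrix_exp (s *\<^sub>R L) $ x $ w * matrix_exp (t *\<^sub>R L) $ w $ z
      = prob {\<omega> \<in> space M. X s \<omega> = w \<and> X (s + t) \<omega> = z}"
    using prob_state[OF x st(1)] prob_state_conditioned[OF st] by simp
  also have "\<dots> \<le> prob {\<omega> \<in> space M. X (s + t) \<omega> = z}"
  proof (rule finite_measure_mono)
    have [measurable]: "X (s + t) \<in> M \<rightarrow>\<^sub>M count_space UNIV" using st by simp
    show "{\<omega> \<in> space M. X (s + t) \<omega> = z} \<in> sets M" by measurable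
  qed auto
  also have "\<dots> = matrix_exp ((s + t) *\<^sub>R L) $ x $ z"
    using prob_state[OF x, of "s + t"] st by simp
  finally show ?thesis .
qed

end

section \<open>The martingale of a nonnegative eigenvector\<close>

text \<open>
  The eigenvector may vanish. In the application it is \<open>\<phi>\<close> extended by \<open>0\<close> to the cemetery point.
\<close>

locale cadlag_markov_eigenvector = cadlag_markov L M X
  for L :: "real^'s^'s::finite" and M :: "'w measure" and X :: "real \<Rightarrow> 'w \<Rightarrow> 's" +
  fixes g :: "real^'s" and c :: real
  assumes eigenvector: "L *v g = (- c) *\<^sub>R g"
    and g_nonneg: "0 \<le> g $ z"
begin

definition eigen_mart :: "real \<Rightarrow> 'w \<Rightarrow> real" where
  "eigen_mart t \<omega> = exp (c * t) * g $ X t \<omega>"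

lemma eigen_mart_nonneg: "0 \<le> eigen_mart t \<omega>"
  by (simp add: eigen_mart_def g_nonneg)

lemma eigen_mart_le:
  assumes "0 \<le> t" "t \<le> N"
  shows "eigen_mart t \<omega> \<le> exp (\<bar>c\<bar> * N) * (\<Sum>z\<in>UNIV. g $ z)"
proof -
  have "c * t \<le> \<bar>c\<bar> * t" using assms by (intro mult_right_mono) auto
  also have "\<dots> \<le> \<bar>c\<bar> * N" using assms by (intro mult_left_mono) auto
  finally have "exp (c * t) \<le> exp (\<bar>c\<bar> * N)" by simp
  moreover have "g $ X t \<omega> \<le> (\<Sum>z\<in>UNIV. g $ z)"
    by (rule member_le_sum[where f = "\<lambda>z. g $ z"]) (simp_all add: g_nonneg)
  ultimately show ?thesis
    unfolding eigen_mart_def by (intro mult_mono) (simp_all add: g_nonneg)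
qed

lemma integrable_indicator_eigen_mart:
  "0 \<le> t \<Longrightarrow> A \<in> sets M \<Longrightarrow> integrable M (\<lambda>\<omega>. indicator A \<omega> * eigen_mart t \<omega>)"
  unfolding eigen_mart_def using integrable_indicator_state[where f = "\<lambda>z. exp (c * t) * g $ z"] .

lemma integrable_eigen_mart: "0 \<le> t \<Longrightarrow> integrable M (eigen_mart t)"
  using integrable_indicator_eigen_mart[of t "space M"]
  by (rule Bochner_Integration.integrable_cong[THEN iffD1, OF refl, rotated]) auto

text \<open>
  The factor \<open>exp (- c t)\<close> that the semigroup produces on \<open>g\<close> cancels the growth of \<open>exp (c t)\<close>.
\<close>

lemma eigen_mart_martingale:
  assumes "0 \<le> s" "0 \<le> t" "A \<in> sets (natural_filtration M X s)"
  shows "(\<integral>\<omega>. indicator A \<omega> * eigen_mart (s + t) \<omega> \<partial>M) = (\<integral>\<omega>. indicator A \<omega> * eigen_mart s \<omega> \<partial>M)"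
proof -
  have P: "matrix_exp (t *\<^sub>R L) *v g = exp (- (c * t)) *\<^sub>R g"
    by (rule matrix_exp_eigenvector)
       (simp add: scaleR_matrix_vector_assoc[symmetric] eigenvector mult.commute)
  have "(\<integral>\<omega>. indicator A \<omega> * eigen_mart (s + t) \<omega> \<partial>M)
      = (\<integral>\<omega>. exp (c * (s + t)) * (indicator A \<omega> * g $ X (s + t) \<omega>) \<partial>M)"
    by (simp add: eigen_mart_def mult_ac)
  also have "\<dots> = (\<integral>\<omega>. exp (c * (s + t)) * (indicator A \<omega> * (exp (- (c * t)) * g $ X s \<omega>)) \<partial>M)"
    using markov_property[OF assms, of g] by (simp add: P)
  also have "\<dots> = (\<integral>\<omega>. indicator A \<omega> * eigen_mart s \<omega> \<partial>M)"
    by (intro Bochner_Integration.integral_cong refl)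
       (simp add: eigen_mart_def exp_minus distrib_left exp_add field_simps)
  finally show ?thesis .
qed

text \<open>
  A nonnegative martingale that is \<open>0\<close> at time \<open>s\<close> has expectation \<open>0\<close> afterwards on that event, so it
  stays at \<open>0\<close>.
\<close>

lemma zero_set_absorbing:
  assumes "0 \<le> s" "s \<le> t"
  shows "AE \<omega> in M. g $ X s \<omega> = 0 \<longrightarrow> g $ X t \<omega> = 0"
proof -
  let ?A = "{\<omega> \<in> space M. g $ X s \<omega> = 0}"
  have "X s -` {z. g $ z = 0} \<inter> space M \<in> sets (natural_filtration M X s)"
    using measurable_sets[OF X_measurable_natural_filtration[OF assms(1) order_refl], of "{z. g $ z = 0}"]
    by simp
  also have "X s -` {z. g $ z = 0} \<inter> space M = ?A" by auto
  finally have A: "?A \<in> sets (natural_filtration M X s)" .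
  have "(\<integral>\<omega>. indicator ?A \<omega> * eigen_mart t \<omega> \<partial>M) = (\<integral>\<omega>. indicator ?A \<omega> * eigen_mart s \<omega> \<partial>M)"
    using eigen_mart_martingale[OF assms(1) _ A, of "t - s"] assms(2) by simp
  also have "\<dots> = 0"
    by (rule integral_eq_zero_AE) (auto simp: indicator_def eigen_mart_def)
  finally have "AE \<omega> in M. indicator ?A \<omega> * eigen_mart t \<omega> = 0"
    using assms integrable_indicator_eigen_mart[of t ?A] natural_filtration_sets_M[OF A]
    by (intro integral_nonneg_eq_0_iff_AE[THEN iffD1]) (simp_all add: eigen_mart_nonneg)
  then show ?thesis
    using AE_space by eventually_elim (auto simp: eigen_mart_def indicator_def split: if_splits)
qed

text \<open>
  If \<open>z\<close> were hit first, right continuity would give rational times \<open>p < q\<close> with the path in \<open>z\<close> at time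
  \<open>p\<close> and in \<open>y\<close> at time \<open>q\<close>, that is, a path leaving the zero set of \<open>g\<close>.
\<close>

lemma hitting_time_zero_set_later:
  assumes g: "0 < g $ y" "g $ z = 0"
  shows "AE \<omega> in M. hitting_time X y \<omega> < \<infinity> \<longrightarrow> hitting_time X y \<omega> < hitting_time X z \<omega>"
proof -
  let ?Q = "{(p, q). p \<in> \<rat> \<and> q \<in> \<rat> \<and> 0 \<le> p \<and> p \<le> q} :: (real \<times> real) set"
  have "countable ?Q"
    by (rule countable_subset[OF _ countable_SIGMA[OF countable_rat countable_rat]]) auto
  then have "AE \<omega> in M. \<forall>r\<in>?Q. g $ X (fst r) \<omega> = 0 \<longrightarrow> g $ X (snd r) \<omega> = 0"
    by (rule AE_ball_countable[THEN iffD2]) (auto intro: zero_set_absorbing)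
  then show ?thesis
    using AE_space
  proof eventually_elim
    case (elim \<omega>)
    note cad = X_cadlag[OF elim(2)]
    show ?case
    proof (rule impI, rule ccontr)
      assume fin: "hitting_time X y \<omega> < \<infinity>" and "\<not> hitting_time X y \<omega> < hitting_time X z \<omega>"
      then have le: "hitting_time X z \<omega> \<le> hitting_time X y \<omega>" by simp
      obtain t where t: "0 \<le> t" "hitting_time X y \<omega> = ereal t" "X t \<omega> = y"
        by (rule hitting_time_attained[of X \<omega> y, OF cad fin])
      obtain s where s: "0 \<le> s" "hitting_time X z \<omega> = ereal s" "X s \<omega> = z"
        by (rule hitting_time_attained[of X \<omega> z, OF cad le_less_trans[OF le fin]])
      have "s \<noteq> t" using g s(3) t(3) by auto
      with le s(2) t(2) have "s < t" by simp
      then obtain p where p: "p \<in> \<rat>" "s < p" "p < t" "X p \<omega> = z"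
        using cadlag_path_rational_right[OF cad s(1), of t] s(3) by auto
      obtain q where q: "q \<in> \<rat>" "t < q" "q < t + 1" "X q \<omega> = y"
        using cadlag_path_rational_right[OF cad t(1), of "t + 1"] t(3) by auto
      have "(p, q) \<in> ?Q" using p q s(1) by simp
      with elim(1) have "g $ X p \<omega> = 0 \<longrightarrow> g $ X q \<omega> = 0" by fastforce
      with g p(4) q(4) show False by simp
    qed
  qed
qed

section \<open>Stopping along a grid\<close>

definition avoids :: "'s \<Rightarrow> real \<Rightarrow> nat \<Rightarrow> 'w set" where
  "avoids y h k = {\<omega> \<in> space M. \<forall>j\<le>k. X (real j * h) \<omega> \<noteq> y}"

lemma avoids_natural_filtration:
  assumes "0 \<le> h"
  shows "avoids y h k \<in> sets (natural_filtration M X (real k * h))"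
proof -
  let ?F = "natural_filtration M X (real k * h)"
  have "avoids y h k = space ?F - (\<Union>j\<in>{..k}. X (real j * h) -` {y} \<inter> space ?F)"
    by (auto simp: avoids_def)
  moreover have "X (real j * h) -` {y} \<inter> space ?F \<in> sets ?F" if "j \<le> k" for j
  proof (rule measurable_sets[OF X_measurable_natural_filtration])
    show "real j * h \<le> real k * h" using that assms by (simp add: mult_right_mono)
  qed (use assms in simp_all)
  ultimately show ?thesis
    by (simp only:) (intro sets.Diff sets.top sets.finite_UN; simp)
qed

lemma avoids_sets [measurable]: "0 \<le> h \<Longrightarrow> avoids y h k \<in> sets M"
  using natural_filtration_sets_M[OF avoids_natural_filtration] .

text \<open>
  The martingale stopped at the first of the times \<open>0, h, \<dots>, k h\<close> at which the path is in \<open>y\<close>, and at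
  \<open>k h\<close> if there is none. Written as a sum of increments, each switched on by an event of the past, its
  expectation is immediate; \<open>stopped_eq\<close> recovers the description by the stopping index.
\<close>

definition stopped :: "'s \<Rightarrow> real \<Rightarrow> nat \<Rightarrow> 'w \<Rightarrow> real" where
  "stopped y h k \<omega> = eigen_mart 0 \<omega>
     + (\<Sum>j<k. indicator (avoids y h j) \<omega> * (eigen_mart (real (Suc j) * h) \<omega> - eigen_mart (real j * h) \<omega>))"

lemma expectation_stopped:
  assumes h: "0 \<le> h"
  shows "integrable M (stopped y h k)" "expectation (stopped y h k) = expectation (eigen_mart 0)"
proof -
  let ?D = "\<lambda>j \<omega>. indicator (avoids y h j) \<omega> * (eigen_mart (real (Suc j) * h) \<omega> - eigen_mart (real j * h) \<omega>)"
  have D: "integrable M (?D j)" "expectation (?D j) = 0" for j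
  proof -
    have i: "integrable M (\<lambda>\<omega>. indicator (avoids y h j) \<omega> * eigen_mart (real i * h) \<omega>)" for i
      using h by (intro integrable_indicator_eigen_mart avoids_sets) auto
    have Suc_j: "real (Suc j) * h = real j * h + h" by (simp add: algebra_simps)
    have "(\<integral>\<omega>. indicator (avoids y h j) \<omega> * eigen_mart (real (Suc j) * h) \<omega> \<partial>M)
        = (\<integral>\<omega>. indicator (avoids y h j) \<omega> * eigen_mart (real j * h) \<omega> \<partial>M)"
      unfolding Suc_j using h by (intro eigen_mart_martingale avoids_natural_filtration) simp_all
    then show "integrable M (?D j)" "expectation (?D j) = 0"
      unfolding right_diff_distrib using i[of "Suc j"] i[of j]
      by (simp_all only: Bochner_Integration.integrable_diff Bochner_Integration.integral_diff diff_self)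
  qed
  have S: "integrable M (\<lambda>\<omega>. \<Sum>j<k. ?D j \<omega>)"
    by (intro Bochner_Integration.integrable_sum D)
  have "expectation (\<lambda>\<omega>. \<Sum>j<k. ?D j \<omega>) = (\<Sum>j<k. expectation (?D j))"
    by (intro Bochner_Integration.integral_sum D)
  also have "\<dots> = 0" by (simp only: D(2) sum.neutral_const)
  finally have "expectation (stopped y h k) = expectation (eigen_mart 0) + 0"
    unfolding stopped_def using Bochner_Integration.integral_add[OF integrable_eigen_mart[OF order_refl] S] by simp
  then show "expectation (stopped y h k) = expectation (eigen_mart 0)" by simp
  show "integrable M (stopped y h k)"
    unfolding stopped_def by (rule Bochner_Integration.integrable_add[OF integrable_eigen_mart[OF order_refl] S])
qed

text \<open>
  The increments before the stopping index \<open>m\<close> telescope and the later ones are switched off.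
\<close>

lemma stopped_eq:
  assumes "\<omega> \<in> space M" "m \<le> k" "\<And>j. j < m \<Longrightarrow> X (real j * h) \<omega> \<noteq> y"
    and "m = k \<or> X (real m * h) \<omega> = y"
  shows "stopped y h k \<omega> = eigen_mart (real m * h) \<omega>"
proof -
  let ?D = "\<lambda>j. indicator (avoids y h j) \<omega> * (eigen_mart (real (Suc j) * h) \<omega> - eigen_mart (real j * h) \<omega>)"
  have "(\<Sum>j<k. ?D j) = (\<Sum>j<m. ?D j)"
    using assms by (intro sum.mono_neutral_right) (auto simp: avoids_def indicator_def not_less)
  also have "\<dots> = (\<Sum>j<m. eigen_mart (real (Suc j) * h) \<omega> - eigen_mart (real j * h) \<omega>)"
    using assms by (intro sum.cong refl) (auto simp: avoids_def)
  also have "\<dots> = eigen_mart (real m * h) \<omega> - eigen_mart (real 0 * h) \<omega>"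
    by (rule sum_lessThan_telescope)
  finally show ?thesis by (simp add: stopped_def)
qed

lemma stopped_bounded:
  assumes "\<omega> \<in> space M" "0 \<le> h"
  shows "\<bar>stopped y h k \<omega>\<bar> \<le> exp (\<bar>c\<bar> * (real k * h)) * (\<Sum>z\<in>UNIV. g $ z)"
proof -
  have "\<exists>m\<le>k. (\<forall>j<m. X (real j * h) \<omega> \<noteq> y) \<and> (m = k \<or> X (real m * h) \<omega> = y)"
  proof (induction k)
    case (Suc k)
    then show ?case
      by (metis le_Suc_eq less_Suc_eq)
  qed simp
  then obtain m where "m \<le> k" "stopped y h k \<omega> = eigen_mart (real m * h) \<omega>"
    using stopped_eq[OF assms(1)] by blast
  then show ?thesis
    using eigen_mart_le[of "real m * h" "real k * h" \<omega>] eigen_mart_nonneg[of "real m * h" \<omega>] assms(2)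
    by (simp add: mult_right_mono)
qed

text \<open>
  The martingale stopped at the minimum of \<open>\<tau>\<^sub>y\<close> and \<open>N\<close>.
\<close>

definition stopped_limit :: "'s \<Rightarrow> real \<Rightarrow> 'w \<Rightarrow> real" where
  "stopped_limit y N \<omega> = (if hitting_time X y \<omega> \<le> ereal N
     then exp (c * real_of_ereal (hitting_time X y \<omega>)) * g $ y else eigen_mart N \<omega>)"

text \<open>
  With mesh \<open>h\<close> the first grid point not before \<open>\<tau>\<^sub>y\<close> is at most \<open>\<tau>\<^sub>y + h\<close>. For small \<open>h\<close> the path is
  still in \<open>y\<close> there, so the stopped martingale is evaluated at a time within \<open>h\<close> of \<open>\<tau>\<^sub>y\<close>.
\<close>

lemma stopped_tendsto:
  assumes \<omega>: "\<omega> \<in> space M" and N: "0 < N"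
  shows "(\<lambda>n. stopped y (N / real (Suc n)) (Suc n) \<omega>) \<longlonglongrightarrow> stopped_limit y N \<omega>"
proof (cases "hitting_time X y \<omega> \<le> ereal N")
  case True
  note cad = X_cadlag[OF \<omega>]
  have "hitting_time X y \<omega> < \<infinity>" using True by (rule le_less_trans) simp
  then obtain t where t: "0 \<le> t" "hitting_time X y \<omega> = ereal t" "X t \<omega> = y"
      "\<And>u. 0 \<le> u \<Longrightarrow> u < t \<Longrightarrow> X u \<omega> \<noteq> y"
    using hitting_time_attained[of X \<omega> y, OF cad] by blast
  have tN: "t \<le> N" using True t(2) by simp
  obtain d where d: "d > 0" "\<And>u. t \<le> u \<Longrightarrow> u < t + d \<Longrightarrow> X u \<omega> = y"
    using cadlag_path_right[OF cad t(1)] t(3) by metis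
  define h where "h n = N / real (Suc n)" for n
  \<comment> \<open>index of the first grid point not before \<open>t\<close>\<close>
  define m where "m n = nat \<lceil>t / h n\<rceil>" for n
  have h_pos: "0 < h n" for n using N by (simp add: h_def)
  have h_lim: "h \<longlonglongrightarrow> 0"
    unfolding h_def using LIMSEQ_Suc[OF lim_const_over_n[of N]] by simp
  have m_ge: "t \<le> real (m n) * h n" and m_lt: "real (m n) * h n < t + h n"
    and m_le: "m n \<le> Suc n" and before: "j < m n \<Longrightarrow> real j * h n < t" for n j
  proof -
    have r: "real (m n) = of_int \<lceil>t / h n\<rceil>" 
      using t(1) h_pos[of n] by (simp add: m_def)
    have "t / h n \<le> real (m n)" unfolding r by linarith
    then show "t \<le> real (m n) * h n" using h_pos[of n] by (simp add: field_simps)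
    have "real (m n) < t / h n + 1" unfolding r by linarith
    then show "real (m n) * h n < t + h n" using h_pos[of n] by (simp add: field_simps)
    have "t / h n \<le> real (Suc n)" 
      unfolding h_def using tN N mult_right_mono[OF tN, of "real (Suc n)"] by (simp add: field_simps)
    then show "m n \<le> Suc n" unfolding m_def by linarith
    assume "j < m n"
    then have "real j < t / h n" unfolding m_def by linarith
    then show "real j * h n < t" using h_pos[of n] by (simp add: field_simps)
  qed
  have "(\<lambda>n. real (m n) * h n) \<longlonglongrightarrow> t"
  proof (rule tendsto_sandwich[where f = "\<lambda>_. t" and h = "\<lambda>n. t + h n"])
    show "(\<lambda>n. t + h n) \<longlonglongrightarrow> t" using tendsto_add[OF tendsto_const h_lim] by simp
  qed (use m_ge less_imp_le[OF m_lt] in simp_all)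
  then have lim: "(\<lambda>n. exp (c * (real (m n) * h n)) * g $ y) \<longlonglongrightarrow> exp (c * t) * g $ y"
    by (intro tendsto_intros)
  have "eventually (\<lambda>n. h n < d) sequentially"
    using order_tendstoD(2)[OF h_lim d(1)] .
  then have "eventually (\<lambda>n. exp (c * (real (m n) * h n)) * g $ y = stopped y (h n) (Suc n) \<omega>) sequentially"
  proof eventually_elim
    case (elim n)
    then have hit: "X (real (m n) * h n) \<omega> = y"
      using d(2) m_ge[of n] m_lt[of n] by simp
    have "stopped y (h n) (Suc n) \<omega> = eigen_mart (real (m n) * h n) \<omega>"
      using hit before[of _ n] t(4) h_pos[of n] by (intro stopped_eq[OF \<omega> m_le]) auto
    with hit show ?case by (simp add: eigen_mart_def)
  qed
  from Lim_transform_eventually[OF lim this] show ?thesis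
    using True t(2) by (simp add: stopped_limit_def h_def)
next
  case False
  have "stopped y (N / real (Suc n)) (Suc n) \<omega> = eigen_mart N \<omega>" for n
  proof -
    have "X (real j * (N / real (Suc n))) \<omega> \<noteq> y" if "j < Suc n" for j
    proof
      assume "X (real j * (N / real (Suc n))) \<omega> = y"
      then have "hitting_time X y \<omega> \<le> ereal (real j * (N / real (Suc n)))"
        using N by (intro hitting_time_le) auto
      also have "real j * (N / real (Suc n)) \<le> N"
        using N mult_left_mono[of "real j" "real (Suc n)" N] that by (simp add: field_simps)
      finally show False using False by simp
    qed
    then show ?thesis
      using stopped_eq[OF \<omega> order_refl, of "Suc n" "N / real (Suc n)" y] by simp
  qed
  then show ?thesis using False by (simp add: stopped_limit_def)
qed

lemma expectation_stopped_limit: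
  assumes N: "0 < N"
  shows "integrable M (stopped_limit y N)" "expectation (stopped_limit y N) = expectation (eigen_mart 0)"
proof -
  let ?s = "\<lambda>n. stopped y (N / real (Suc n)) (Suc n)"
  let ?B = "exp (\<bar>c\<bar> * N) * (\<Sum>z\<in>UNIV. g $ z)"
  have s: "integrable M (?s n)" "expectation (?s n) = expectation (eigen_mart 0)" for n
    using expectation_stopped[of "N / real (Suc n)"] N by simp_all
  have lim: "AE \<omega> in M. (\<lambda>n. ?s n \<omega>) \<longlonglongrightarrow> stopped_limit y N \<omega>"
    using stopped_tendsto[OF _ N] by simp
  have meas: "?s n \<in> borel_measurable M" for n using s(1) by simp
  have meas_lim: "stopped_limit y N \<in> borel_measurable M"
    using meas stopped_tendsto[OF _ N] by (rule borel_measurable_LIMSEQ_metric)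
  have bound: "AE \<omega> in M. norm (?s n \<omega>) \<le> ?B" for n
    using stopped_bounded[of _ "N / real (Suc n)" y "Suc n"] N by (simp del: of_nat_Suc)
  note dc = meas_lim meas _ lim bound
  show "integrable M (stopped_limit y N)"
    by (rule integrable_dominated_convergence[OF dc]) simp
  have "(\<lambda>n. expectation (?s n)) \<longlonglongrightarrow> expectation (stopped_limit y N)"
    by (rule integral_dominated_convergence[OF dc]) simp
  then show "expectation (stopped_limit y N) = expectation (eigen_mart 0)"
    unfolding s(2) using LIMSEQ_unique tendsto_const by blast
qed

section \<open>Passage to an infinite horizon\<close>

text \<open>
  The mass of the paths that avoid \<open>y\<close> up to step \<open>k\<close> is preserved by the next step, where it splits into
  the mass of the paths that still avoid \<open>y\<close> and the mass now sitting in \<open>y\<close>. By the lower bound on the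
  transitions to \<open>y\<close>, the latter is at least a fixed proportion \<open>\<delta>\<close> of the whole, so the decay is
  geometric.
\<close>

lemma avoiding_mass_decay:
  assumes H: "0 \<le> H" and y: "0 < g $ y" and eps: "0 < \<epsilon>"
    and minor: "\<And>w. \<epsilon> * g $ w \<le> matrix_exp (H *\<^sub>R L) $ w $ y"
  shows "(\<lambda>k. \<integral>\<omega>. indicator (avoids y H k) \<omega> * eigen_mart (real k * H) \<omega> \<partial>M) \<longlonglongrightarrow> 0"
proof -
  define a where "a k = (\<integral>\<omega>. indicator (avoids y H k) \<omega> * eigen_mart (real k * H) \<omega> \<partial>M)" for k
  define \<delta> where "\<delta> = g $ y * exp (c * H) * \<epsilon>"
  \<comment> \<open>the case \<open>1 - \<delta> < 0\<close> forces the mass to be \<open>0\<close> at once; truncation keeps the ratio nonnegative\<close>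
  define q where "q = max 0 (1 - \<delta>)"
  have q: "0 \<le> q" "q < 1" using y eps by (auto simp: q_def \<delta>_def)
  have a_nonneg: "0 \<le> a k" for k
    unfolding a_def by (intro Bochner_Integration.integral_nonneg) (simp add: eigen_mart_nonneg)
  have step: "a (Suc k) \<le> (1 - \<delta>) * a k" for k
  proof -
    let ?t = "real k * H"
    let ?A = "avoids y H k"
    have t: "0 \<le> ?t" "0 \<le> ?t + H" using H by auto
    have Suc_t: "real (Suc k) * H = ?t + H" by (simp add: algebra_simps)
    have A: "?A \<in> sets (natural_filtration M X ?t)" by (rule avoids_natural_filtration[OF H])
    have AM: "?A \<in> sets M" using A by (rule natural_filtration_sets_M)
    let ?E = "exp (c * (?t + H)) * g $ y"
    have split: "indicator ?A \<omega> * eigen_mart (?t + H) \<omega>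
        = indicator (avoids y H (Suc k)) \<omega> * eigen_mart (?t + H) \<omega>
          + ?E * (indicator ?A \<omega> * indicator {y} (X (?t + H) \<omega>))" if "\<omega> \<in> space M" for \<omega>
      using that by (auto simp: avoids_def indicator_def eigen_mart_def le_Suc_eq algebra_simps)
    have "a k = (\<integral>\<omega>. indicator ?A \<omega> * eigen_mart (?t + H) \<omega> \<partial>M)"
      unfolding a_def using eigen_mart_martingale[OF t(1) H A] by simp
    also have "\<dots> = (\<integral>\<omega>. indicator (avoids y H (Suc k)) \<omega> * eigen_mart (?t + H) \<omega>
          + ?E * (indicator ?A \<omega> * indicator {y} (X (?t + H) \<omega>)) \<partial>M)"
      by (intro Bochner_Integration.integral_cong refl split)
    also have "\<dots> = a (Suc k) + ?E * (\<integral>\<omega>. indicator ?A \<omega> * indicator {y} (X (?t + H) \<omega>) \<partial>M)"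
      unfolding a_def Suc_t using H t AM
      by (subst Bochner_Integration.integral_add)
         (auto intro!: integrable_indicator_eigen_mart integrable_indicator_state)
    finally have "a k = a (Suc k) + ?E * (\<integral>\<omega>. indicator ?A \<omega> * indicator {y} (X (?t + H) \<omega>) \<partial>M)" .
    moreover have "\<delta> * a k \<le> ?E * (\<integral>\<omega>. indicator ?A \<omega> * indicator {y} (X (?t + H) \<omega>) \<partial>M)"
    proof -
      have "\<delta> * a k = ?E * (\<integral>\<omega>. indicator ?A \<omega> * (\<epsilon> * g $ X ?t \<omega>) \<partial>M)"
        unfolding a_def \<delta>_def eigen_mart_def
        by (simp add: distrib_left exp_add mult_ac flip: Bochner_Integration.integral_mult_right_zero)
      also have "\<dots> \<le> ?E * (\<integral>\<omega>. indicator ?A \<omega> * matrix_exp (H *\<^sub>R L) $ X ?t \<omega> $ y \<partial>M)"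
        using t AM y minor
        by (intro mult_left_mono integral_mono integrable_indicator_state[where f = "\<lambda>w. \<epsilon> * g $ w"]
            integrable_indicator_state[where f = "\<lambda>w. matrix_exp (H *\<^sub>R L) $ w $ y"]) auto
      also have "\<dots> = ?E * (\<integral>\<omega>. indicator ?A \<omega> * indicator {y} (X (?t + H) \<omega>) \<partial>M)"
        using markov_property_state[OF t(1) H A] by simp
      finally show ?thesis .
    qed
    ultimately show ?thesis by (simp add: algebra_simps)
  qed
  have bound: "a k \<le> q ^ k * a 0" for k
  proof (induction k)
    case (Suc k)
    have "a (Suc k) \<le> (1 - \<delta>) * a k" by (rule step)
    also have "\<dots> \<le> q * a k" by (intro mult_right_mono a_nonneg) (simp add: q_def)
    also have "\<dots> \<le> q * (q ^ k * a 0)" by (intro mult_left_mono Suc.IH q)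
    finally show ?case by (simp add: mult_ac)
  qed simp
  have "a \<longlonglongrightarrow> 0"
  proof (rule tendsto_sandwich[where f = "\<lambda>_. 0" and h = "\<lambda>k. q ^ k * a 0"])
    show "(\<lambda>k. q ^ k * a 0) \<longlonglongrightarrow> 0"
      using tendsto_mult_left_zero[OF LIMSEQ_realpow_zero[OF q]] .
  qed (use a_nonneg bound in simp_all)
  then show ?thesis by (simp add: a_def [abs_def])
qed

text \<open>
  The identity for the martingale stopped at \<open>\<tau>\<^sub>y \<and> N\<close> is taken along \<open>N = (k + 1) H\<close>. Its part on
  \<open>{\<tau>\<^sub>y \<le> N}\<close> increases to \<open>V\<close>, and its part on \<open>{\<tau>\<^sub>y > N}\<close> is dominated by the mass of the paths that
  avoid \<open>y\<close> at the multiples of \<open>H\<close>. The exponential moment is therefore finite as well, by monotone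
  convergence.
\<close>

lemma expectation_exp_hitting_time:
  assumes H: "0 < H" and y: "0 < g $ y" and eps: "0 < \<epsilon>"
    and minor: "\<And>w. \<epsilon> * g $ w \<le> matrix_exp (H *\<^sub>R L) $ w $ y"
  defines "V \<equiv> \<lambda>\<omega>. exp (c * real_of_ereal (hitting_time X y \<omega>)) * indicator {\<omega>. hitting_time X y \<omega> < \<infinity>} \<omega>"
  shows "integrable M V" "g $ y * expectation V = expectation (eigen_mart 0)"
proof -
  define V' where "V' k \<omega> = exp (c * real_of_ereal (hitting_time X y \<omega>))
      * indicator {\<omega>. hitting_time X y \<omega> \<le> ereal (real (Suc k) * H)} \<omega>" for k \<omega>
  define R where "R k \<omega> = eigen_mart (real (Suc k) * H) \<omega>
      * indicator {\<omega>. ereal (real (Suc k) * H) < hitting_time X y \<omega>} \<omega>" for k \<omega>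
  have N: "0 < real (Suc k) * H" for k using H by simp
  have limit: "stopped_limit y (real (Suc k) * H) \<omega> = g $ y * V' k \<omega> + R k \<omega>" for k \<omega>
    by (auto simp: stopped_limit_def V'_def R_def indicator_def)
  have eigen_mart_meas [measurable]: "eigen_mart (real (Suc k) * H) \<in> borel_measurable M" for k
    using integrable_eigen_mart[of "real (Suc k) * H"] N[of k] by auto
  have R_meas [measurable]: "R k \<in> borel_measurable M" for k
    unfolding R_def by measurable
  have R_int: "integrable M (R k)" for k
    by (rule Bochner_Integration.integrable_bound[OF integrable_eigen_mart[OF less_imp_le[OF N]]])
       (auto simp: R_def indicator_def)
  have V'_int: "integrable M (V' k)" for k
  proof -
    have "integrable M (\<lambda>\<omega>. (stopped_limit y (real (Suc k) * H) \<omega> - R k \<omega>) / g $ y)"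
      by (intro integrable_divide Bochner_Integration.integrable_diff expectation_stopped_limit N R_int)
    then show ?thesis using y unfolding limit by simp
  qed
  have V'_expectation: "expectation (V' k) = (expectation (eigen_mart 0) - expectation (R k)) / g $ y" for k
  proof -
    have "expectation (stopped_limit y (real (Suc k) * H)) = g $ y * expectation (V' k) + expectation (R k)"
      unfolding limit[abs_def] using V'_int R_int by (simp add: Bochner_Integration.integral_add)
    then show ?thesis
      using expectation_stopped_limit(2)[OF N[of k], of y] y by (simp add: field_simps)
  qed
  have R_lim: "(\<lambda>k. expectation (R k)) \<longlonglongrightarrow> 0"
  proof (rule tendsto_sandwich[where f = "\<lambda>_. 0"
        and h = "\<lambda>k. \<integral>\<omega>. indicator (avoids y H (Suc k)) \<omega> * eigen_mart (real (Suc k) * H) \<omega> \<partial>M"])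
    show "(\<lambda>k. \<integral>\<omega>. indicator (avoids y H (Suc k)) \<omega> * eigen_mart (real (Suc k) * H) \<omega> \<partial>M) \<longlonglongrightarrow> 0"
      using LIMSEQ_Suc[OF avoiding_mass_decay[OF less_imp_le[OF H] y eps minor]] .
    show "eventually (\<lambda>k. 0 \<le> expectation (R k)) sequentially"
      by (simp add: R_def eigen_mart_nonneg Bochner_Integration.integral_nonneg)
    have "expectation (R k) \<le> (\<integral>\<omega>. indicator (avoids y H (Suc k)) \<omega> * eigen_mart (real (Suc k) * H) \<omega> \<partial>M)" for k
    proof (rule integral_mono)
      fix \<omega> assume \<omega>: "\<omega> \<in> space M"
      have "\<omega> \<in> avoids y H (Suc k)" if late: "ereal (real (Suc k) * H) < hitting_time X y \<omega>"
      proof -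
        have "X (real j * H) \<omega> \<noteq> y" if "j \<le> Suc k" for j
        proof
          assume "X (real j * H) \<omega> = y"
          then have "hitting_time X y \<omega> \<le> ereal (real j * H)"
            using H by (intro hitting_time_le) auto
          also have "\<dots> \<le> ereal (real (Suc k) * H)"
            using that H by simp
          finally show False using late by simp
        qed
        then show ?thesis using \<omega> by (simp add: avoids_def)
      qed
      then show "R k \<omega> \<le> indicator (avoids y H (Suc k)) \<omega> * eigen_mart (real (Suc k) * H) \<omega>"
        by (auto simp: R_def indicator_def eigen_mart_nonneg)
    qed (use H N in \<open>auto intro!: R_int integrable_indicator_eigen_mart avoids_sets simp del: of_nat_Suc\<close>)
    then show "eventually (\<lambda>k. expectation (R k)
        \<le> (\<integral>\<omega>. indicator (avoids y H (Suc k)) \<omega> * eigen_mart (real (Suc k) * H) \<omega> \<partial>M)) sequentially"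
      by (simp del: of_nat_Suc)
  qed simp
  have "(\<lambda>k. (expectation (eigen_mart 0) - expectation (R k)) / g $ y) \<longlonglongrightarrow> (expectation (eigen_mart 0) - 0) / g $ y"
    using y by (intro tendsto_intros R_lim) simp
  then have V'_lim: "(\<lambda>k. expectation (V' k)) \<longlonglongrightarrow> expectation (eigen_mart 0) / g $ y"
    by (simp add: V'_expectation)
  have mono: "AE \<omega> in M. mono (\<lambda>k. V' k \<omega>)"
  proof (rule AE_I2, rule monoI)
    fix \<omega> and i j :: nat assume "i \<le> j"
    then have "ereal (real (Suc i) * H) \<le> ereal (real (Suc j) * H)" using H by simp
    then show "V' i \<omega> \<le> V' j \<omega>"
      unfolding V'_def by (intro mult_left_mono) (auto simp: indicator_def intro: order_trans)
  qed
  have lim: "AE \<omega> in M. (\<lambda>k. V' k \<omega>) \<longlonglongrightarrow> V \<omega>"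
  proof (rule AE_I2)
    fix \<omega> assume \<omega>: "\<omega> \<in> space M"
    show "(\<lambda>k. V' k \<omega>) \<longlonglongrightarrow> V \<omega>"
    proof (cases "hitting_time X y \<omega> < \<infinity>")
      case True
      obtain t where t: "hitting_time X y \<omega> = ereal t"
        by (rule hitting_time_attained[of X \<omega> y, OF X_cadlag[OF \<omega>] True])
      obtain n where n: "t < real n * H" using ex_less_of_nat_mult[OF H] by blast
      have "eventually (\<lambda>k. V \<omega> = V' k \<omega>) sequentially"
        using eventually_ge_at_top[of n]
      proof eventually_elim
        case (elim k)
        then have "real n * H \<le> real (Suc k) * H" using H by simp
        with n have "t \<le> real (Suc k) * H" by linarith
        then show ?case by (simp add: V_def V'_def t del: of_nat_Suc)
      qed
      then show ?thesis by (rule Lim_transform_eventually[OF tendsto_const])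
    next
      case False
      then show ?thesis by (simp add: V_def V'_def)
    qed
  qed
  have V_meas: "V \<in> borel_measurable M" unfolding V_def by measurable
  have V'_nonneg: "AE \<omega> in M. 0 \<le> V' k \<omega>" for k by (simp add: V'_def)
  note mc = integral_monotone_convergence_nonneg[OF V'_int mono V'_nonneg lim V'_lim V_meas]
  show "integrable M V" by (rule mc(1))
  show "g $ y * expectation V = expectation (eigen_mart 0)" using mc(2) y by simp
qed

end

section \<open>Positive transition probabilities from irreducibility\<close>

text \<open>
  For small \<open>h > 0\<close> the transitions in time \<open>h\<close> along edges, and from each state to itself, have positive
  probability. Waiting and then following a path of edges gives positivity at all large multiples of
  \<open>h\<close>, for each pair of states; since there are finitely many pairs, one multiple serves them all.
\<close>

lemma common_time_positive_transitions:
  fixes L :: "real^('a::finite option)^('a option)"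
  assumes irr: "irreducible_matrix (restrict_S L)"
    and process: "\<And>x. cadlag_markov_process L (M x) (X x)"
    and start: "\<And>x. starts_from (M x) (X x) (Some x)"
  obtains H where "0 < H" "\<And>x y. 0 < matrix_exp (H *\<^sub>R L) $ Some x $ Some y"
proof -
  define P where "P t x y = matrix_exp (t *\<^sub>R L) $ Some x $ Some y" for t x y
  have mult: "P s x w * P t w z \<le> P (s + t) x z" if "0 \<le> s" "0 \<le> t" for s t x w z
  proof -
    interpret cadlag_markov L "M x" "X x" by unfold_locales (rule process)
    show ?thesis unfolding P_def by (rule transition_product_le[OF start that])
  qed
  have "eventually (\<lambda>t. x = y \<or> 0 < L $ Some x $ Some y \<longrightarrow> 0 < P t x y) (at_right 0)" for x y
  proof (cases "x = y \<or> 0 < L $ Some x $ Some y")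
    case True
    then have "eventually (\<lambda>t. 0 < P t x y) (at_right 0)"
      unfolding P_def by (intro matrix_exp_entry_pos_near_0) auto
    then show ?thesis by (rule eventually_mono) simp
  qed simp
  then have "eventually (\<lambda>t. \<forall>x y. x = y \<or> 0 < L $ Some x $ Some y \<longrightarrow> 0 < P t x y) (at_right 0)"
    by (intro eventually_all_finite) auto
  then have "eventually (\<lambda>t. 0 < t \<and> (\<forall>x y. x = y \<or> 0 < L $ Some x $ Some y \<longrightarrow> 0 < P t x y)) (at_right 0)"
    using eventually_at_right_less by (intro eventually_conj)
  then obtain h where h: "0 < h" "\<And>x. 0 < P h x x" "\<And>x y. 0 < L $ Some x $ Some y \<Longrightarrow> 0 < P h x y"
    using eventually_happens'[OF trivial_limit_at_right_real] by blast
  have advance: "0 < P (real (Suc n) * h) x z" if "0 < P (real n * h) x w" "0 < P h w z" for n x w z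
  proof -
    have "0 < P (real n * h) x w * P h w z" using that by simp
    also have "\<dots> \<le> P (real n * h + h) x z" using h(1) by (intro mult) auto
    finally show ?thesis by (simp add: algebra_simps)
  qed
  have "eventually (\<lambda>n. 0 < P (real n * h) x y) sequentially" for x y
  proof -
    have "(x, y) \<in> {(u, v). 0 < restrict_S L $ u $ v}\<^sup>*"
      using irr by (simp add: irreducible_matrix_def)
    then show ?thesis
    proof (induction rule: rtrancl_induct)
      case base
      have "0 < P (real n * h) x x" for n
      proof (induction n)
        case 0
        then show ?case by (simp add: P_def matrix_exp_zero mat_def)
      next
        case (Suc n)
        then show ?case using advance h(2) by blast
      qed
      then show ?case by simp
    next
      case (step w z)
      have "0 < P h w z" using step.hyps(2) h(3) by (simp add: restrict_S_def)
      with step.IH have "eventually (\<lambda>n. 0 < P (real (Suc n) * h) x z) sequentially"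
        by (auto elim!: eventually_mono intro: advance simp del: of_nat_Suc)
      then show ?case by (simp only: eventually_sequentially_Suc[where P = "\<lambda>n. 0 < P (real n * h) x z"])
    qed
  qed
  then have "eventually (\<lambda>n. \<forall>x y. 0 < P (real n * h) x y) sequentially"
    by (intro eventually_all_finite) auto
  then obtain n where n: "0 < n" "\<And>x y. 0 < P (real n * h) x y"
    using eventually_happens'[OF sequentially_bot eventually_conj[OF _ eventually_gt_at_top[of 0]]]
    by blast
  show ?thesis
    using that[of "real n * h"] n h(1) by (simp add: P_def)
qed

section \<open>The eigenvalue and the amplitude\<close>

definition extend_by_zero :: "real^'a \<Rightarrow> real^('a::finite option)" where
  "extend_by_zero \<phi> = (\<chi> z. case z of None \<Rightarrow> 0 | Some x \<Rightarrow> \<phi> $ x)"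

lemma extend_by_zero_simps [simp]:
  "extend_by_zero \<phi> $ None = 0" "extend_by_zero \<phi> $ Some x = \<phi> $ x"
  by (simp_all add: extend_by_zero_def)

lemma sum_option: "(\<Sum>z\<in>UNIV. f z) = f None + (\<Sum>x\<in>UNIV. f (Some x))"
  for f :: "'a::finite option \<Rightarrow> real"
  by (simp add: UNIV_option_conv sum.reindex)

lemma extend_by_zero_eigenvector:
  assumes "\<forall>z. L $ None $ z = 0" "restrict_S L *v \<phi> = \<mu> *\<^sub>R \<phi>"
  shows "L *v extend_by_zero \<phi> = \<mu> *\<^sub>R extend_by_zero \<phi>"
proof -
  have "(L *v extend_by_zero \<phi>) $ z = (\<mu> *\<^sub>R extend_by_zero \<phi>) $ z" for z
  proof (cases z)
    case None
    then show ?thesis using assms(1) by (simp add: matrix_vector_mult_def)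
  next
    case (Some x)
    have "(\<Sum>k\<in>UNIV. L $ Some x $ Some k * \<phi> $ k) = \<mu> * \<phi> $ x"
      using arg_cong[OF assms(2), of "\<lambda>v. v $ x"] by (simp add: matrix_vector_mult_def restrict_S_def)
    then show ?thesis using Some by (simp add: matrix_vector_mult_def sum_option)
  qed
  then show ?thesis by (simp add: vec_eq_iff)
qed

text \<open>
  The eigenvalue equation, rewritten with the zero row sums in terms of the differences of \<open>\<phi>\<close>. At an
  extremal point of \<open>\<phi>\<close> all terms on the left have the same sign; this is the maximum principle.
\<close>

lemma eigenvector_balance:
  assumes gen: "markov_generator L" and eig: "restrict_S L *v \<phi> = (- l0) *\<^sub>R \<phi>"
  shows "(\<Sum>k\<in>UNIV. L $ Some x $ Some k * (\<phi> $ k - \<phi> $ x)) = (L $ Some x $ None - l0) * \<phi> $ x"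
proof -
  have row: "L $ Some x $ None + (\<Sum>k\<in>UNIV. L $ Some x $ Some k) = 0"
    using gen by (simp add: markov_generator_def sum_option[symmetric])
  have "(\<Sum>k\<in>UNIV. L $ Some x $ Some k * \<phi> $ k) = - l0 * \<phi> $ x"
    using arg_cong[OF eig, of "\<lambda>v. v $ x"] by (simp add: matrix_vector_mult_def restrict_S_def)
  moreover have "(\<Sum>k\<in>UNIV. L $ Some x $ Some k) = - L $ Some x $ None" using row by simp
  ultimately show ?thesis
    by (simp add: right_diff_distrib sum_subtractf left_diff_distrib flip: sum_distrib_right)
qed

text \<open>
  If \<open>l0 \<le> 0\<close>, then at a maximum point the balance has a left side \<open>\<le> 0\<close> and a right side \<open>\<ge> 0\<close>. So both
  vanish: no exit is possible there and all neighbours are maximum points as well. By irreducibility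
  no state has an exit.
\<close>

lemma eigenvalue_pos:
  assumes gen: "markov_generator L" and irr: "irreducible_matrix (restrict_S L)"
    and exit: "\<exists>x. 0 < L $ Some x $ None"
    and eig: "restrict_S L *v \<phi> = (- l0) *\<^sub>R \<phi>" and pos: "\<forall>x. 0 < \<phi> $ x"
  shows "0 < l0"
proof (rule ccontr)
  assume "\<not> 0 < l0"
  have rate: "0 \<le> L $ Some x $ z" if "z \<noteq> Some x" for x z
    using gen that by (auto simp: markov_generator_def)
  define m where "m = (MAX x. \<phi> $ x)"
  have le: "\<phi> $ x \<le> m" for x unfolding m_def by (intro Max_ge) auto
  have "m \<in> range (\<lambda>x. \<phi> $ x)" unfolding m_def by (intro Max_in) auto
  then obtain x0 where x0: "\<phi> $ x0 = m" by auto
  have at_max: "L $ Some x $ None = 0 \<and> (\<forall>k. 0 < L $ Some x $ Some k \<longrightarrow> \<phi> $ k = m)"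
    if x: "\<phi> $ x = m" for x
  proof -
    have nonpos: "L $ Some x $ Some k * (\<phi> $ k - \<phi> $ x) \<le> 0" for k
      using rate[of "Some k" x] le[of k] x by (cases "k = x") (auto simp: mult_nonneg_nonpos)
    have "(L $ Some x $ None - l0) * \<phi> $ x \<le> 0"
      unfolding eigenvector_balance[OF gen eig, symmetric] by (intro sum_nonpos nonpos)
    then have "L $ Some x $ None - l0 \<le> 0"
      using pos by (simp add: mult_le_0_iff not_le[symmetric])
    with rate[of None x] \<open>\<not> 0 < l0\<close> have zero: "L $ Some x $ None = 0" "l0 = 0" by auto
    then have "(\<Sum>k\<in>UNIV. - (L $ Some x $ Some k * (\<phi> $ k - \<phi> $ x))) = 0"
      using eigenvector_balance[OF gen eig, of x] by (simp add: sum_negf)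
    then have terms: "\<forall>k\<in>UNIV. - (L $ Some x $ Some k * (\<phi> $ k - \<phi> $ x)) = 0"
      using nonpos by (subst (asm) sum_nonneg_eq_0_iff) auto
    have "\<phi> $ k = m" if "0 < L $ Some x $ Some k" for k
      using bspec[OF terms UNIV_I, of k] that x by simp
    with zero show ?thesis by blast
  qed
  have "\<phi> $ x = m" for x
  proof -
    have "(x0, x) \<in> {(u, v). 0 < restrict_S L $ u $ v}\<^sup>*"
      using irr by (simp add: irreducible_matrix_def)
    then show ?thesis
      by (induction rule: rtrancl_induct) (use x0 at_max in \<open>auto simp: restrict_S_def\<close>)
  qed
  with at_max exit show False by fastforce
qed

text \<open>
  At a minimum point the left side of the balance is \<open>\<ge> 0\<close>, so the exit rate is at least \<open>l0\<close>.
\<close>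

lemma minimizer_in_exit_states:
  assumes gen: "markov_generator L" and l0: "0 < l0"
    and eig: "restrict_S L *v \<phi> = (- l0) *\<^sub>R \<phi>" and pos: "\<forall>x. 0 < \<phi> $ x"
    and min: "\<And>k. \<phi> $ x \<le> \<phi> $ k"
  shows "x \<in> exit_states L"
proof -
  have "0 \<le> L $ Some x $ Some k * (\<phi> $ k - \<phi> $ x)" for k
    using gen min[of k] by (cases "k = x") (auto simp: markov_generator_def)
  then have "0 \<le> (L $ Some x $ None - l0) * \<phi> $ x"
    unfolding eigenvector_balance[OF gen eig, symmetric] by (intro sum_nonneg)
  moreover have "0 < \<phi> $ x" using pos by simp
  ultimately have "0 \<le> L $ Some x $ None - l0"
    by (simp add: zero_le_mult_iff)
  with l0 show ?thesis by (simp add: exit_states_def)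
qed

lemma amplitude_eq_Max_ratio:
  assumes pos: "\<forall>x. 0 < \<phi> $ x"
    and E: "\<And>x. (\<And>k. \<phi> $ x \<le> \<phi> $ k) \<Longrightarrow> x \<in> E"
  shows "amplitude \<phi> = (MAX (x, y) \<in> UNIV \<times> E. \<phi> $ x / \<phi> $ y)"
proof -
  let ?max = "MAX x. \<phi> $ x" and ?min = "MIN x. \<phi> $ x"
  have le: "?min \<le> \<phi> $ x" "\<phi> $ x \<le> ?max" for x
    by (auto intro: Min_le Max_ge)
  have "?max \<in> range (\<lambda>x. \<phi> $ x)" "?min \<in> range (\<lambda>x. \<phi> $ x)"
    by (intro Max_in Min_in; simp)+
  then obtain a b where ab: "\<phi> $ a = ?max" "\<phi> $ b = ?min" by (metis imageE)
  have "b \<in> E" using le(1) ab(2) by (intro E) simp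
  have "(MAX (x, y) \<in> UNIV \<times> E. \<phi> $ x / \<phi> $ y) = \<phi> $ a / \<phi> $ b"
  proof (rule Max_eqI)
    show "finite ((\<lambda>(x, y). \<phi> $ x / \<phi> $ y) ` (UNIV \<times> E))" by simp
    show "\<phi> $ a / \<phi> $ b \<in> (\<lambda>(x, y). \<phi> $ x / \<phi> $ y) ` (UNIV \<times> E)"
      using \<open>b \<in> E\<close> by force
    show "r \<le> \<phi> $ a / \<phi> $ b" if r: "r \<in> (\<lambda>(x, y). \<phi> $ x / \<phi> $ y) ` (UNIV \<times> E)" for r
    proof -
      obtain x y where "r = \<phi> $ x / \<phi> $ y" using r by auto
      moreover have "\<phi> $ x / \<phi> $ y \<le> \<phi> $ a / \<phi> $ b"
        using pos le[of x] le[of y] unfolding ab[symmetric] by (intro frac_le) (simp_all add: less_imp_le)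
      ultimately show ?thesis by simp
    qed
  qed
  then show ?thesis by (simp add: amplitude_def ab)
qed

section \<open>The ratio formula and the amplitude formula\<close>

text \<open>
  The general formula applies with \<open>g\<close> the extension of \<open>\<phi>\<close>. The uniform lower bound on the transitions
  to \<open>y\<close> comes from positivity at time \<open>H\<close> and finiteness of the state space.
\<close>

lemma expectation_exp_hit_before_killing:
  fixes L :: "real^('a::finite option)^('a option)"
  assumes absorbing: "\<forall>z. L $ None $ z = 0"
    and eig: "restrict_S L *v \<phi> = (- c) *\<^sub>R \<phi>" and pos: "\<forall>x. 0 < \<phi> $ x"
    and process: "cadlag_markov_process L M X" and start: "starts_from M X (Some x)"
    and H: "0 < H" "\<And>x. 0 < matrix_exp (H *\<^sub>R L) $ Some x $ Some y"
  shows "integrable M (exp_hit_before_killing c X y)"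
    and "(\<integral>\<omega>. exp_hit_before_killing c X y \<omega> \<partial>M) = \<phi> $ x / \<phi> $ y"
proof -
  define g where "g = extend_by_zero \<phi>"
  have g_simps: "g $ None = 0" "g $ Some k = \<phi> $ k" for k
    by (simp_all add: g_def)
  have g_nonneg: "0 \<le> g $ z" for z
    using pos by (cases z) (auto simp: g_simps less_imp_le)
  interpret cadlag_markov_eigenvector L M X g c
    using process extend_by_zero_eigenvector[OF absorbing eig] g_nonneg
    by unfold_locales (auto simp: g_def)
  let ?P = "\<lambda>k. matrix_exp (H *\<^sub>R L) $ Some k $ Some y"
  \<comment> \<open>at \<open>None\<close> the lower bound needed below is trivial, as \<open>g\<close> vanishes there\<close>
  define \<epsilon> where "\<epsilon> = (MIN k. ?P k) / (MAX k. \<phi> $ k)"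
  have num: "0 < (MIN k. ?P k)"
    using H(2) by (simp add: Min_gr_iff)
  have "0 < \<phi> $ x" using pos by simp
  also have "\<phi> $ x \<le> (MAX k. \<phi> $ k)" by (intro Max_ge) auto
  finally have den: "0 < (MAX k. \<phi> $ k)" .
  have eps: "0 < \<epsilon>" using num den by (simp add: \<epsilon>_def)
  have minor: "\<epsilon> * g $ w \<le> matrix_exp (H *\<^sub>R L) $ w $ Some y" for w
  proof (cases w)
    case None
    then show ?thesis
      using absorbing by (simp add: g_simps matrix_exp_zero_row mat_def)
  next
    case (Some k)
    have "\<epsilon> * \<phi> $ k \<le> \<epsilon> * (MAX k. \<phi> $ k)"
      using eps by (intro mult_left_mono Max_ge) auto
    also have "\<dots> = (MIN k. ?P k)" using den by (simp add: \<epsilon>_def)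
    also have "\<dots> \<le> ?P k" by (intro Min_le) auto
    finally show ?thesis by (simp add: Some g_simps)
  qed
  have gy: "0 < g $ Some y" using pos by (simp add: g_simps)
  let ?V = "\<lambda>\<omega>. exp (c * real_of_ereal (hitting_time X (Some y) \<omega>))
    * indicator {\<omega>. hitting_time X (Some y) \<omega> < \<infinity>} \<omega>"
  note V = expectation_exp_hitting_time[OF H(1) gy eps minor]
  have V_eq: "AE \<omega> in M. ?V \<omega> = exp_hit_before_killing c X y \<omega>"
    using hitting_time_zero_set_later[OF gy g_simps(1)]
    by eventually_elim (auto simp: exp_hit_before_killing_def indicator_def)
  have meas: "?V \<in> borel_measurable M" "exp_hit_before_killing c X y \<in> borel_measurable M"
    unfolding exp_hit_before_killing_def[abs_def] by measurable
  show "integrable M (exp_hit_before_killing c X y)"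
    using integrable_cong_AE[THEN iffD1, OF meas V_eq V(1)] .
  have "expectation (eigen_mart 0) = (\<integral>\<omega>. \<phi> $ x \<partial>M)"
  proof (rule integral_cong_AE)
    show "eigen_mart 0 \<in> borel_measurable M" using integrable_eigen_mart[of 0] by auto
    show "AE \<omega> in M. eigen_mart 0 \<omega> = \<phi> $ x"
      using start unfolding starts_from_def by eventually_elim (simp add: eigen_mart_def g_simps)
  qed simp
  also have "\<dots> = \<phi> $ x" by (simp add: prob_space)
  finally have "\<phi> $ y * expectation ?V = \<phi> $ x" using V(2) by (simp add: g_simps)
  moreover have "expectation ?V = expectation (exp_hit_before_killing c X y)"
    by (rule integral_cong_AE[OF meas V_eq])
  ultimately show "expectation (exp_hit_before_killing c X y) = \<phi> $ x / \<phi> $ y"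
    using gy by (simp add: g_simps field_simps)
qed

theorem proposition1:
  fixes L :: "real^('a::finite option)^('a option)"
    and \<phi> :: "real^'a"
    and l0 :: real
    and M :: "'a \<Rightarrow> 'w measure"
    and X :: "'a \<Rightarrow> real \<Rightarrow> 'w \<Rightarrow> 'a option"
  assumes "markov_generator L"
    and "irreducible_matrix (restrict_S L)"
    and "\<forall>z. L $ None $ z = 0"
    and "\<exists>x. 0 < L $ Some x $ None"
    and "restrict_S L *v \<phi> = (- l0) *\<^sub>R \<phi>"
    and "\<forall>x. 0 < \<phi> $ x"
    and "\<forall>x. cadlag_markov_process L (M x) (X x)"
    and "\<forall>x. starts_from (M x) (X x) (Some x)"
  shows "(\<forall>x y. integrable (M x) (exp_hit_before_killing l0 (X x) y) \<and>
            \<phi> $ x / \<phi> $ y = (\<integral>\<omega>. exp_hit_before_killing l0 (X x) y \<omega> \<partial>M x)) \<and>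
         amplitude \<phi> =
           (MAX (x, y) \<in> UNIV \<times> exit_states L. \<integral>\<omega>. exp_hit_before_killing l0 (X x) y \<omega> \<partial>M x)"
proof -
  obtain H where H: "0 < H" "\<And>x y. 0 < matrix_exp (H *\<^sub>R L) $ Some x $ Some y"
    using common_time_positive_transitions[OF assms(2), of M X] assms(7,8) by blast
  have ratio: "integrable (M x) (exp_hit_before_killing l0 (X x) y)"
      "(\<integral>\<omega>. exp_hit_before_killing l0 (X x) y \<omega> \<partial>M x) = \<phi> $ x / \<phi> $ y" for x y
    using expectation_exp_hit_before_killing[OF assms(3,5,6) _ _ H(1), of "M x" "X x" x y] H(2) assms(7,8)
    by auto
  have "0 < l0" by (rule eigenvalue_pos[OF assms(1,2,4,5,6)])
  then have "amplitude \<phi> = (MAX (x, y) \<in> UNIV \<times> exit_states L. \<phi> $ x / \<phi> $ y)"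
    using minimizer_in_exit_states[OF assms(1) _ assms(5,6)]
    by (intro amplitude_eq_Max_ratio assms(6)) blast
  then show ?thesis by (simp add: ratio)
qed

end
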